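(* The class of $L$-algebras is not a variety in the sense of Universal Algebra; that is, it is not the class of all algebras (with one binary operation $\cdot$ and one constant $1$) satisfying some set of identities.
   Context: An $L$-algebra is a set $X$ with a binary operation $(x,y)\mapsto x\cdot y$ and a constant $1\in X$ such that for all $x,y,z\in X$: (1) $x\cdot x=x\cdot 1=1$ and $1\cdot x=x$; (2) $(x\cdot y)\cdot(x\cdot z)=(y\cdot x)\cdot(y\cdot z)$; (3) $x\cdot y=y\cdot x=1$ implies $x=y$. *)

theory Defs
  imports Main
begin

record 'a alg =
  carrier :: "'a set"
  dot :: "'a \<Rightarrow> 'a \<Rightarrow> 'a" (infixl "\<cdot>\<index>" 70)
  unit :: 'a ("\<one>\<index>")

locale algebra =
  fixes A :: "'a alg" (structure)
  assumes dot_closed: "\<lbrakk>x \<in> carrier A; y \<in> carrier A\<rbrakk> \<Longrightarrow> x \<cdot> y \<in> carrier A"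
    and unit_closed: "\<one> \<in> carrier A"

locale L_algebra = algebra +
  assumes dot_self: "x \<in> carrier A \<Longrightarrow> x \<cdot> x = \<one>"
    and dot_unit: "x \<in> carrier A \<Longrightarrow> x \<cdot> \<one> = \<one>"
    and unit_dot: "x \<in> carrier A \<Longrightarrow> \<one> \<cdot> x = x"
    and cycloid: "\<lbrakk>x \<in> carrier A; y \<in> carrier A; z \<in> carrier A\<rbrakk>
      \<Longrightarrow> (x \<cdot> y) \<cdot> (x \<cdot> z) = (y \<cdot> x) \<cdot> (y \<cdot> z)"
    and antisym: "\<lbrakk>x \<in> carrier A; y \<in> carrier A; x \<cdot> y = \<one>; y \<cdot> x = \<one>\<rbrakk> \<Longrightarrow> x = y"

datatype trm = Var nat | Dot trm trm | Unit

type_synonym identity = "trm \<times> trm"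

primrec trm_value :: "'a alg \<Rightarrow> (nat \<Rightarrow> 'a) \<Rightarrow> trm \<Rightarrow> 'a" where
  "trm_value A v (Var n) = v n"
| "trm_value A v (Dot s t) = trm_value A v s \<cdot>\<^bsub>A\<^esub> trm_value A v t"
| "trm_value A v Unit = \<one>\<^bsub>A\<^esub>"

definition satisfies :: "'a alg \<Rightarrow> identity \<Rightarrow> bool" where
  "satisfies A e \<longleftrightarrow>
    (\<forall>v. (\<forall>n. v n \<in> carrier A) \<longrightarrow> trm_value A v (fst e) = trm_value A v (snd e))"

(* HOL cannot quantify over all types, so a class of algebras is represented by its members
   whose carrier is a subset of the type 'a. If a set of identities axiomatises a class over
   all types, it does so over each single type; hence failing to be a variety relative to one
   type already refutes being a variety in the unrestricted sense. *)
definition variety :: "'a alg set \<Rightarrow> bool" where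
  "variety K \<longleftrightarrow> (\<exists>E :: identity set. K = {A. algebra A \<and> (\<forall>e\<in>E. satisfies A e)})"

end

(* Varieties are closed under homomorphic images, and L-algebras are not. On {1, i, a, b} let
   a . b = b . a = i, let i . y = y for y \<noteq> i, and let a . i = b . i = 1; with the forced
   products this is an L-algebra. Collapsing i to 1 yields the algebra {1, a, b} in which
   a . b = b . a = 1 although a \<noteq> b. *)
theory Submission
  imports Defs
begin

text \<open>A homomorphism law is assumed only on the carrier, so the induction over
  \<open>Dot\<close> below needs the values of both subterms to lie there.\<close>

lemma trm_value_in_carrier:
  assumes "algebra A" and "\<And>n. v n \<in> carrier A"
  shows "trm_value A v t \<in> carrier A"
  using assms by (induction t) (auto intro: algebra.dot_closed algebra.unit_closed)

lemma trm_value_hom: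
  assumes "algebra A" and "\<And>n. v n \<in> carrier A"
    and "\<And>x y. \<lbrakk>x \<in> carrier A; y \<in> carrier A\<rbrakk> \<Longrightarrow> h (x \<cdot>\<^bsub>A\<^esub> y) = h x \<cdot>\<^bsub>B\<^esub> h y"
    and "h \<one>\<^bsub>A\<^esub> = \<one>\<^bsub>B\<^esub>"
  shows "h (trm_value A v t) = trm_value B (h \<circ> v) t"
  by (induction t) (simp_all add: assms trm_value_in_carrier)

text \<open>By surjectivity, a valuation in \<open>B\<close> lifts to one in \<open>A\<close>, where
  the identity holds; \<open>h\<close> carries the equality back.\<close>

lemma satisfies_hom_image:
  assumes "algebra A" and "satisfies A e"
    and hom: "\<And>x y. \<lbrakk>x \<in> carrier A; y \<in> carrier A\<rbrakk> \<Longrightarrow> h (x \<cdot>\<^bsub>A\<^esub> y) = h x \<cdot>\<^bsub>B\<^esub> h y"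
    and unit: "h \<one>\<^bsub>A\<^esub> = \<one>\<^bsub>B\<^esub>"
    and image: "carrier B = h ` carrier A"
  shows "satisfies B e"
  unfolding satisfies_def
proof (intro allI impI)
  fix v :: "nat \<Rightarrow> _"
  assume "\<forall>n. v n \<in> carrier B"
  then have "\<forall>n. \<exists>x. x \<in> carrier A \<and> h x = v n"
    unfolding image by (metis imageE)
  then obtain w where w: "\<And>n. w n \<in> carrier A" and "\<And>n. h (w n) = v n"
    by metis
  then have v: "v = h \<circ> w"
    by auto
  have "trm_value A w (fst e) = trm_value A w (snd e)"
    using assms(2) w by (simp add: satisfies_def)
  then show "trm_value B v (fst e) = trm_value B v (snd e)"
    unfolding v by (simp flip: trm_value_hom[where h = h, OF assms(1) w hom unit])
qed

text \<open>For distinct parameters, reading \<open>x \<cdot> y = u\<close> as x \<le> y gives the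
  order with \<open>a\<close> and \<open>b\<close> incomparable below \<open>i\<close>, and
  \<open>i\<close> below \<open>u\<close>.\<close>

definition collapsible_alg :: "'a \<Rightarrow> 'a \<Rightarrow> 'a \<Rightarrow> 'a \<Rightarrow> 'a alg" where
  "collapsible_alg u i a b = \<lparr>carrier = {u, i, a, b},
    dot = (\<lambda>x y. if x = u then y else if x = y then u else if x = i then y
      else if y = u \<or> y = i then u else i),
    unit = u\<rparr>"

definition collapsed_alg :: "'a \<Rightarrow> 'a \<Rightarrow> 'a \<Rightarrow> 'a alg" where
  "collapsed_alg u a b = \<lparr>carrier = {u, a, b}, dot = (\<lambda>x y. if x = u then y else u), unit = u\<rparr>"

lemma L_algebra_collapsible_alg:
  assumes "distinct [u, i, a, b]"
  shows "L_algebra (collapsible_alg u i a b)"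
proof -
  have neq: "u \<noteq> i" "u \<noteq> a" "u \<noteq> b" "i \<noteq> a" "i \<noteq> b" "a \<noteq> b"
    using assms by auto
  show ?thesis
    \<comment> \<open>Each law is a finite check: membership in the carrier splits into cases, and
      \<open>neq\<close> decides every conditional.\<close>
    by unfold_locales
      (use neq in \<open>simp only: collapsible_alg_def alg.simps insert_iff empty_iff simp_thms;
          elim disjE; simp\<close>)+
qed

lemma algebra_collapsed_alg: "algebra (collapsed_alg u a b)"
  by unfold_locales (auto simp: collapsed_alg_def)

lemma not_L_algebra_collapsed_alg:
  assumes "distinct [u, a, b]"
  shows "\<not> L_algebra (collapsed_alg u a b)"
  using L_algebra.antisym[of "collapsed_alg u a b" a b] assms
  by (auto simp: collapsed_alg_def)

lemma satisfies_collapsed_alg: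
  assumes "distinct [u, i, a, b]" and "satisfies (collapsible_alg u i a b) e"
  shows "satisfies (collapsed_alg u a b) e"
\<comment> \<open>This map merges \<open>i\<close> into \<open>u\<close> and fixes the rest, so the
  products \<open>a \<cdot> b\<close> and \<open>b \<cdot> a\<close>, both equal to
  \<open>i\<close>, become \<open>u\<close>.\<close>
proof (rule satisfies_hom_image[where h = "\<lambda>x. if x = i then u else x"])
  show "algebra (collapsible_alg u i a b)"
    using L_algebra_collapsible_alg[OF assms(1)] by (simp add: L_algebra_def)
qed (use assms in \<open>auto simp: collapsible_alg_def collapsed_alg_def\<close>)

theorem mainTheorem4:
  assumes "infinite (UNIV :: 'a set)"
  shows "\<not> variety {A :: 'a alg. L_algebra A}"
proof
  \<comment> \<open>Infinitude supplies four distinct elements of the type.\<close>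
  obtain T :: "'a set" where "finite T" and "card T = 4"
    using infinite_arbitrarily_large[OF assms] by blast
  then obtain xs :: "'a list" where xs: "distinct xs" "length xs = 4"
    by (metis finite_distinct_list distinct_card)
  then obtain u i a b :: 'a where "xs = [u, i, a, b]"
    by (auto simp: numeral_eq_Suc length_Suc_conv)
  with xs have dist: "distinct [u, i, a, b]"
    by simp
  assume "variety {A :: 'a alg. L_algebra A}"
  then obtain E where
    "{A :: 'a alg. L_algebra A} = {A. algebra A \<and> (\<forall>e\<in>E. satisfies A e)}"
    unfolding variety_def by (elim exE)
  then have E: "L_algebra A \<longleftrightarrow> algebra A \<and> (\<forall>e\<in>E. satisfies A e)" for A :: "'a alg"
    unfolding set_eq_iff mem_Collect_eq by (rule spec)
  \<comment> \<open>\<open>E\<close> holds in the four-element L-algebra, hence in its image, which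
    \<open>E\<close> would then force to be an L-algebra.\<close>
  have "L_algebra (collapsed_alg u a b)"
    unfolding E
    using algebra_collapsed_alg L_algebra_collapsible_alg[OF dist, unfolded E]
      satisfies_collapsed_alg[OF dist] by simp
  then show False
    using not_L_algebra_collapsed_alg[of u a b] dist by simp
qed

end
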